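(* Let $p$ be a prime, $n\ge 2$ an integer, $\gamma\in\mathbb{Z}$, and let $\underline{a}=(a_0,a_1,\ldots,a_n,\ldots)$ be an almost $p$-ary sequence of period $n+1$ (so $a_0=0$). Let $H=\langle h\rangle$ and $P=\langle g\rangle$ be (multiplicatively written) cyclic groups of order $n+1$ and $p$, respectively, and let $G=H\times P$. Fix a primitive $p$-th root of unity $\zeta_p\in\mathbb{C}$, and for $1\le i\le n$ let $b_i\in\{0,1,\ldots,p-1\}$ be the integer such that $a_i=\zeta_p^{b_i}$. Let $$R=\{g^{b_i}h^i\in G : 1\le i\le n\}.$$ Then $\underline{a}$ is an almost $p$-ary nearly perfect sequence of type $\gamma$ if and only if $R$ is an $\left(n+1,p,n,\frac{n-\gamma-1}{p}+\gamma,0,\frac{n-\gamma-1}{p}\right)$-direct product difference set in $G$ relative to $H$ and $P$. In particular, in that case $p$ divides $n-\gamma-1$.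
   Context: An almost $p$-ary sequence of period $N$ is a sequence $\underline{a}=(a_0,a_1,\ldots)$ of complex numbers of period $N$ (so $a_{i+N}=a_i$) with $a_0=0$ and with $a_1,\ldots,a_{N-1}$ all powers of a primitive $p$-th root of unity $\zeta_p\in\mathbb{C}$. Its autocorrelation function is $C_{\underline{a}}(t)=\sum_{i=0}^{N-1}a_i\overline{a_{i+t}}$ for $0\le t\le N-1$. The sequence is a nearly perfect sequence (NPS) of type $\gamma$ if $C_{\underline{a}}(t)=\gamma$ for all $1\le t\le N-1$. Let $G=H\times N'$ be a group with $|H|=m$ and $|N'|=n'$ ($H$ and $N'$ are regarded as subgroups of $G$). A subset $R\subseteq G$ is an $(m,n',k,\lambda_1,\lambda_2,\mu)$-direct product difference set (DPDS) in $G$ relative to $H$ and $N'$ if $|R|=k$ and the differences $r_1r_2^{-1}$, with $r_1,r_2\in R$, $r_1\ne r_2$, represent every non-identity element of $H$ exactly $\lambda_1$ times, every non-identity element of $N'$ exactly $\lambda_2$ times, and every element of $G\setminus(H\cup N')$ exactly $\mu$ times. *)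

theory Defs
  imports Complex_Main "HOL-Computational_Algebra.Primes" "HOL-Algebra.Elementary_Groups"
begin

definition primitive_root_of_unity :: "nat \<Rightarrow> complex \<Rightarrow> bool" where
  "primitive_root_of_unity p \<zeta> \<longleftrightarrow> p > 0 \<and> \<zeta> ^ p = 1 \<and> (\<forall>k\<in>{1..<p}. \<zeta> ^ k \<noteq> 1)"

definition almost_p_ary_sequence :: "nat \<Rightarrow> nat \<Rightarrow> (nat \<Rightarrow> complex) \<Rightarrow> bool" where
  "almost_p_ary_sequence p N a \<longleftrightarrow>
     (\<forall>i. a (i + N) = a i) \<and> a 0 = 0 \<and>
     (\<exists>\<zeta>. primitive_root_of_unity p \<zeta> \<and> (\<forall>i\<in>{1..<N}. \<exists>k::nat. a i = \<zeta> ^ k))"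

definition autocorrelation :: "nat \<Rightarrow> (nat \<Rightarrow> complex) \<Rightarrow> nat \<Rightarrow> complex" where
  "autocorrelation N a t = (\<Sum>i<N. a i * cnj (a (i + t)))"

definition almost_p_ary_nearly_perfect ::
    "nat \<Rightarrow> nat \<Rightarrow> complex \<Rightarrow> (nat \<Rightarrow> complex) \<Rightarrow> bool" where
  "almost_p_ary_nearly_perfect p N \<gamma> a \<longleftrightarrow>
     almost_p_ary_sequence p N a \<and> (\<forall>t\<in>{1..<N}. autocorrelation N a t = \<gamma>)"

text \<open>The external product \<open>H \<times> K\<close>, with its factors regarded as subgroups, is the
  same thing up to isomorphism as a group whose multiplication map on two subgroups
  is an isomorphism.\<close>

definition internal_direct_product :: "('a, 'b) monoid_scheme \<Rightarrow> 'a set \<Rightarrow> 'a set \<Rightarrow> bool" where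
  "internal_direct_product G H K \<longleftrightarrow>
     group G \<and> subgroup H G \<and> subgroup K G \<and>
     (\<lambda>(x, y). x \<otimes>\<^bsub>G\<^esub> y) \<in> iso (subgroup_generated G H \<times>\<times> subgroup_generated G K) G"

definition difference_count :: "('a, 'b) monoid_scheme \<Rightarrow> 'a set \<Rightarrow> 'a \<Rightarrow> nat" where
  "difference_count G R x =
     card {(r, s). r \<in> R \<and> s \<in> R \<and> r \<noteq> s \<and> r \<otimes>\<^bsub>G\<^esub> inv\<^bsub>G\<^esub> s = x}"

text \<open>The parameters \<open>l1\<close>, \<open>l2\<close>, \<open>\<mu>\<close> are rational so that fractional expressions
  can be used for them without rounding; a number of representations can only equal a
  parameter that is a natural number.\<close>

definition direct_product_difference_set ::
    "('a, 'b) monoid_scheme \<Rightarrow> 'a set \<Rightarrow> 'a set \<Rightarrow> 'a set \<Rightarrow>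
     nat \<Rightarrow> nat \<Rightarrow> nat \<Rightarrow> rat \<Rightarrow> rat \<Rightarrow> rat \<Rightarrow> bool" where
  "direct_product_difference_set G H K R m n' k l1 l2 \<mu> \<longleftrightarrow>
     internal_direct_product G H K \<and> finite (carrier G) \<and> card H = m \<and> card K = n' \<and>
     R \<subseteq> carrier G \<and> card R = k \<and>
     (\<forall>x\<in>H - {\<one>\<^bsub>G\<^esub>}. of_nat (difference_count G R x) = l1) \<and>
     (\<forall>x\<in>K - {\<one>\<^bsub>G\<^esub>}. of_nat (difference_count G R x) = l2) \<and>
     (\<forall>x\<in>carrier G - (H \<union> K). of_nat (difference_count G R x) = \<mu>)"

end

theory Submission
  imports Defs "HOL-Algebra.Multiplicative_Group"
    "HOL-Computational_Algebra.Polynomial_Factorial"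
begin

text \<open>
  For a shift \<open>s\<close> with \<open>1 \<le> s \<le> n\<close>, both sides of the equivalence are governed by the same
  numbers \<open>w\<^sub>s(\<beta>)\<close>: the number of pairs of nonzero entries \<open>a\<^sub>i\<close>, \<open>a\<^sub>j\<close> with
  \<open>j \<equiv> i + s (mod n + 1)\<close> and \<open>b\<^sub>i - b\<^sub>j \<equiv> \<beta> (mod p)\<close>. On the analytic side,
  \<open>C(s) = \<Sum>\<^sub>\<beta> w\<^sub>s(\<beta>) \<zeta>\<^sup>\<beta>\<close> (\<open>autocorrelation_eq_character_sum\<close>), because each pair contributes
  \<open>\<zeta>\<close> to the power \<open>b\<^sub>i - b\<^sub>j\<close>. On the group side, \<open>w\<^sub>s(\<beta>)\<close> is the number of ways to write
  \<open>g\<^sup>\<beta> h\<^sup>-\<^sup>s\<close> as a quotient of two points of \<open>R\<close> (\<open>difference_count_eq_lag_count\<close>). These elements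
  are all those outside \<open>P\<close>, and they lie in \<open>H\<close> exactly when \<open>\<beta> = 0\<close>. No nontrivial element
  of \<open>P\<close> is a quotient of two points, since \<open>R\<close> has at most one point over each power of \<open>h\<close>.

  It remains to see that \<open>\<Sum>\<^sub>\<beta> w\<^sub>s(\<beta>) \<zeta>\<^sup>\<beta> = \<gamma>\<close> holds iff \<open>w\<^sub>s\<close> takes a constant value \<open>\<mu>\<close> on
  \<open>\<beta> \<noteq> 0\<close> and \<open>w\<^sub>s(0) = \<mu> + \<gamma>\<close>. The only integer relations among \<open>1, \<zeta>, \<dots>, \<zeta>\<^sup>p\<^sup>-\<^sup>1\<close> are the
  multiples of \<open>1 + \<zeta> + \<dots> + \<zeta>\<^sup>p\<^sup>-\<^sup>1 = 0\<close> (\<open>vanishing_int_combination_of_prime_roots\<close>), which is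
  the irreducibility of the \<open>p\<close>-th cyclotomic polynomial and is obtained here from Eisenstein's
  criterion. The value of \<open>\<mu>\<close> comes from counting: for each shift there are \<open>n - 1\<close> pairs in
  all, so \<open>p \<mu> + \<gamma> = n - 1\<close>. As \<open>\<mu>\<close> is then a number of pairs, \<open>p\<close> divides \<open>n - \<gamma> - 1\<close>.
\<close>

section \<open>Eisenstein's criterion\<close>

text \<open>
  Modulo \<open>p\<close>, the lowest nonzero coefficient of \<open>F\<close>, multiplied by the constant coefficient of
  \<open>Q\<close>, survives in \<open>F * Q\<close>; so all of the vanishing low coefficients of the product must be
  accounted for by \<open>F\<close> alone.
\<close>

lemma eisenstein_degree_bound:
  fixes F Q :: "int poly"
  assumes "prime p" and "p dvd coeff F 0" and "\<not> p dvd coeff Q 0" and "\<not> p dvd lead_coeff F"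
    and low: "\<And>k. k < n \<Longrightarrow> p dvd coeff (F * Q) k"
  shows "n \<le> degree F"
proof -
  define k where "k = (LEAST k. \<not> p dvd coeff F k)"
  have k: "\<not> p dvd coeff F k"
    unfolding k_def by (rule LeastI_ex) (use assms(4) in blast)
  have k_le: "k \<le> degree F"
    unfolding k_def by (rule Least_le) (fact assms(4))
  have less: "p dvd coeff F i" if "i < k" for i
    using not_less_Least[of i "\<lambda>k. \<not> p dvd coeff F k"] that by (auto simp: k_def)
  have "coeff (F * Q) k = (\<Sum>i<k. coeff F i * coeff Q (k - i)) + coeff F k * coeff Q 0"
    by (simp add: coeff_mult lessThan_Suc_atMost[symmetric])
  moreover have "p dvd (\<Sum>i<k. coeff F i * coeff Q (k - i))"
    by (intro dvd_sum dvd_mult2 less) auto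
  moreover have "\<not> p dvd coeff F k * coeff Q 0"
    using k assms(1,3) by (simp add: prime_dvd_mult_iff)
  ultimately have "\<not> p dvd coeff (F * Q) k"
    by (simp add: dvd_add_right_iff)
  with low have "n \<le> k" by (meson not_le)
  with k_le show ?thesis by simp
qed

text \<open>
  Since \<open>p\<^sup>2\<close> does not divide the constant coefficient, \<open>p\<close> divides that of only one of two
  factors. The degree bound gives this factor the whole degree, and the other factor is a constant
  dividing the leading coefficient \<open>1\<close>.
\<close>

lemma eisenstein_irreducible:
  fixes F :: "int poly"
  assumes p: "prime p" and monic: "lead_coeff F = 1" and deg: "degree F > 0"
    and low: "\<And>k. k < degree F \<Longrightarrow> p dvd coeff F k" and sq: "\<not> p\<^sup>2 dvd coeff F 0"
  shows "irreducible F"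
proof (rule irreducibleI)
  show "F \<noteq> 0" using deg by auto
  show "\<not> is_unit F"
    using deg by (auto simp: is_unit_poly_iff)
  have cofactor_unit: "is_unit B"
    if AB: "F = A * B" and "p dvd coeff A 0" for A B
  proof -
    have nz: "A \<noteq> 0" "B \<noteq> 0" using AB \<open>F \<noteq> 0\<close> by auto
    have lead: "lead_coeff A * lead_coeff B = 1"
      using monic AB by (simp add: lead_coeff_mult)
    have "\<not> p dvd lead_coeff A"
      using lead p by (metis dvd_mult2 not_prime_unit)
    moreover have "\<not> p dvd coeff B 0"
      using sq that(2) by (auto simp: AB coeff_mult power2_eq_square intro: mult_dvd_mono)
    ultimately have "degree F \<le> degree A"
      using eisenstein_degree_bound[OF p that(2)] low AB by blast
    hence "degree B = 0" using nz by (simp add: AB degree_mult_eq)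
    then obtain c where "B = [:c:]" by (auto elim: degree_eq_zeroE)
    moreover have "c dvd 1"
      using lead calculation by (metis dvd_triv_right lead_coeff_pCons(2))
    ultimately show ?thesis by (simp add: is_unit_const_poly_iff)
  qed
  fix A B assume AB: "F = A * B"
  have "p dvd coeff F 0" using low deg by blast
  hence "p dvd coeff A 0 \<or> p dvd coeff B 0"
    using p by (simp add: AB coeff_mult prime_dvd_mult_iff)
  thus "is_unit A \<or> is_unit B"
    using cofactor_unit[of A B] cofactor_unit[of B A] AB by (auto simp: mult.commute)
qed

section \<open>Integer polynomials vanishing at a complex number\<close>

abbreviation ipoly :: "int poly \<Rightarrow> complex \<Rightarrow> complex" where
  "ipoly f z \<equiv> poly (map_poly of_int f) z"

lemma ipoly_pCons [simp]: "ipoly (pCons c f) z = of_int c + z * ipoly f z"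
  by (simp add: map_poly_pCons)

lemma ipoly_add: "ipoly (f + g) z = ipoly f z + ipoly g z"
  by (induction f g rule: poly_induct2) (auto simp: algebra_simps)

lemma ipoly_smult: "ipoly (smult c f) z = of_int c * ipoly f z"
  by (induction f) (auto simp: algebra_simps)

lemma ipoly_mult: "ipoly (f * g) z = ipoly f z * ipoly g z"
  by (induction f) (auto simp: algebra_simps ipoly_add ipoly_smult)

lemma ipoly_pcompose: "ipoly (pcompose f g) z = ipoly f (ipoly g z)"
  by (induction f) (auto simp: pcompose_pCons ipoly_add ipoly_mult)

text \<open>
  Gauss's lemma enters as the fact that an irreducible integer polynomial is a prime element of the
  factorial ring \<open>\<int>[x]\<close>. Let \<open>m\<close> be a nonzero integer polynomial of least degree vanishing at \<open>z\<close>.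
  Pseudo-division gives \<open>c F = m q\<close>, so \<open>F\<close> divides \<open>m\<close> or \<open>q\<close>. In the second case \<open>m\<close> would
  divide the constant \<open>c\<close>, which does not vanish at \<open>z\<close>.
\<close>

lemma int_poly_root_degree_ge:
  fixes F f :: "int poly" and z :: complex
  assumes irr: "irreducible F"
    and Fz: "ipoly F z = 0" and fz: "ipoly f z = 0" and "f \<noteq> 0"
  shows "degree F \<le> degree f"
proof -
  define d where "d = (LEAST d. \<exists>q::int poly. q \<noteq> 0 \<and> ipoly q z = 0 \<and> degree q = d)"
  have "\<exists>q::int poly. q \<noteq> 0 \<and> ipoly q z = 0 \<and> degree q = d"
    unfolding d_def by (rule LeastI_ex) (use assms in blast)
  then obtain m :: "int poly" where m: "m \<noteq> 0" "ipoly m z = 0" "degree m = d"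
    by blast
  have minimal: "degree m \<le> degree q" if "q \<noteq> 0" "ipoly q z = 0" for q :: "int poly"
    unfolding m(3) d_def by (rule Least_le) (use that in blast)
  define r where "r = pseudo_mod F m"
  obtain c q where cq: "c \<noteq> 0" "smult c F = m * q + r" and r: "r = 0 \<or> degree r < degree m"
    using pseudo_mod[OF m(1), of F] unfolding r_def by blast
  have "ipoly r z = 0"
    using arg_cong[OF cq(2), of "\<lambda>q. ipoly q z"] Fz m(2)
    by (simp add: ipoly_add ipoly_mult ipoly_smult del: of_int_eq_0_iff)
  with minimal r have "r = 0" by (meson not_le)
  hence eq: "smult c F = m * q" using cq by simp
  have "prime_elem F" using irr by (rule irreducible_imp_prime_elem)
  hence "F dvd m \<or> F dvd q"
    using eq by (metis prime_elem_dvd_mult_iff dvd_smult dvd_refl)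
  moreover have "\<not> F dvd q"
  proof
    assume "F dvd q"
    then obtain s where "q = F * s" by blast
    hence "F * [:c:] = F * (m * s)" using eq by (simp add: mult_ac)
    moreover have "F \<noteq> 0" using irr by auto
    ultimately have "m * s = [:c:]" by (metis mult_left_cancel)
    hence "ipoly m z * ipoly s z = of_int c"
      by (simp flip: ipoly_mult)
    thus False using m cq by simp
  qed
  ultimately have "degree F \<le> degree m"
    using m(1) by (blast intro: dvd_imp_degree_le)
  also have "\<dots> \<le> degree f" using minimal assms by blast
  finally show ?thesis .
qed

section \<open>Integer relations between roots of unity of prime order\<close>

lemma prime_dvd_binomial:
  assumes "prime p" "0 < k" "k < p"
  shows "p dvd (p choose k)"
proof -
  have "k * (p choose k) = p * ((p - 1) choose (k - 1))"
    using assms binomial_absorption[of "k - 1" "p"] by simp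
  hence "p dvd k * (p choose k)" by simp
  moreover have "\<not> p dvd k" using assms by (auto dest: dvd_imp_le)
  ultimately show ?thesis using assms(1) by (simp add: prime_dvd_mult_iff)
qed

text \<open>
  For prime \<open>p\<close> this is \<open>\<Phi>\<^sub>p(x + 1) = ((x + 1)\<^sup>p - 1) / x\<close>, written out by the binomial theorem:
  in this form the hypotheses of Eisenstein's criterion can be read off.
\<close>

definition shifted_cyclotomic :: "nat \<Rightarrow> int poly" where
  "shifted_cyclotomic p = (\<Sum>k<p. monom (int (p choose Suc k)) k)"

lemma coeff_shifted_cyclotomic:
  "coeff (shifted_cyclotomic p) k = (if k < p then int (p choose Suc k) else 0)"
  by (simp add: shifted_cyclotomic_def coeff_sum)

lemma degree_shifted_cyclotomic:
  assumes "p > 0" shows "degree (shifted_cyclotomic p) = p - 1"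
proof (rule antisym)
  show "degree (shifted_cyclotomic p) \<le> p - 1"
    by (rule degree_le) (auto simp: coeff_shifted_cyclotomic)
  show "p - 1 \<le> degree (shifted_cyclotomic p)"
    using assms by (intro le_degree) (simp add: coeff_shifted_cyclotomic)
qed

lemma irreducible_shifted_cyclotomic:
  assumes p: "prime p"
  shows "irreducible (shifted_cyclotomic p)"
proof (rule eisenstein_irreducible)
  have p1: "p > 1" using p by (rule prime_gt_1_nat)
  note deg = degree_shifted_cyclotomic[of p]
  show "prime (int p)" using p by simp
  show "lead_coeff (shifted_cyclotomic p) = 1"
    using p1 by (simp add: deg coeff_shifted_cyclotomic)
  show "degree (shifted_cyclotomic p) > 0"
    using p1 by (simp add: deg)
  show "int p dvd coeff (shifted_cyclotomic p) k" if "k < degree (shifted_cyclotomic p)" for k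
    using that p1 p by (simp add: deg coeff_shifted_cyclotomic prime_dvd_binomial)
  have "\<not> p * p dvd p" using p1 by (auto dest: dvd_imp_le)
  hence "\<not> int (p * p) dvd int p" by (simp only: int_dvd_int_iff not_False_eq_True)
  thus "\<not> (int p)\<^sup>2 dvd coeff (shifted_cyclotomic p) 0"
    using p1 by (simp add: coeff_shifted_cyclotomic power2_eq_square)
qed

lemma ipoly_sum_monom: "ipoly (\<Sum>k<n. monom (c k) k) z = (\<Sum>k<n. of_int (c k) * z ^ k)"
  by (induction n) (auto simp: ipoly_add map_poly_monom poly_monom)

lemma ipoly_shifted_cyclotomic: "z * ipoly (shifted_cyclotomic p) z = (z + 1) ^ p - 1"
proof -
  have "(z + 1) ^ p = (\<Sum>k<Suc p. of_nat (p choose k) * z ^ k)"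
    by (simp add: binomial_ring lessThan_Suc_atMost)
  also have "\<dots> = 1 + (\<Sum>k<p. of_nat (p choose Suc k) * z ^ Suc k)"
    by (subst sum.lessThan_Suc_shift) simp
  finally show ?thesis
    by (simp add: shifted_cyclotomic_def ipoly_sum_monom sum_distrib_left mult_ac)
qed

text \<open>
  Subtracting a multiple of \<open>1 + \<zeta> + \<dots> + \<zeta>\<^sup>p\<^sup>-\<^sup>1 = 0\<close> removes the coefficient of \<open>\<zeta>\<^sup>p\<^sup>-\<^sup>1\<close>. What is
  left is a polynomial of degree less than \<open>p - 1\<close>, and it must be zero: after the substitution
  \<open>x + 1\<close> for \<open>x\<close> it vanishes at \<open>\<zeta> - 1\<close>, a root of an irreducible polynomial of degree \<open>p - 1\<close>.
\<close>

lemma vanishing_int_combination_of_prime_roots: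
  fixes c :: "nat \<Rightarrow> int" and \<zeta> :: complex
  assumes p: "prime p" and \<zeta>: "\<zeta> ^ p = 1" "\<zeta> \<noteq> 1"
    and vanish: "(\<Sum>j<p. of_int (c j) * \<zeta> ^ j) = 0" and "j < p"
  shows "c j = c 0"
proof -
  have p1: "p > 1" using p by (rule prime_gt_1_nat)
  have geometric: "(\<Sum>j<p. \<zeta> ^ j) = 0"
    using \<zeta> by (simp add: geometric_sum)
  define f where "f = (\<Sum>j<p. monom (c j - c (p - 1)) j)"
  have coeff_f: "coeff f i = (if i < p then c i - c (p - 1) else 0)" for i
    by (simp add: f_def coeff_sum)
  have "ipoly f \<zeta> = (\<Sum>j<p. of_int (c j) * \<zeta> ^ j) - of_int (c (p - 1)) * (\<Sum>j<p. \<zeta> ^ j)"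
    by (simp add: f_def ipoly_sum_monom sum_subtractf sum_distrib_left sum_distrib_right algebra_simps)
  hence "ipoly f \<zeta> = 0" using vanish geometric by simp
  hence "ipoly (pcompose f [:1, 1:]) (\<zeta> - 1) = 0"
    by (simp add: ipoly_pcompose)
  moreover have "ipoly (shifted_cyclotomic p) (\<zeta> - 1) = 0"
    using ipoly_shifted_cyclotomic[of "\<zeta> - 1" p] \<zeta> by simp
  ultimately have "p - 1 \<le> degree f" if "f \<noteq> 0"
    using int_poly_root_degree_ge[OF irreducible_shifted_cyclotomic[OF p]] that p1
    by (fastforce simp: degree_shifted_cyclotomic pcompose_eq_0_iff degree_pcompose)
  moreover have "degree f < p - 1" if "f \<noteq> 0"
  proof -
    have "degree f \<le> p - 1" by (rule degree_le) (auto simp: coeff_f)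
    moreover have "degree f \<noteq> p - 1"
      using that coeff_f[of "p - 1"] by (metis diff_self leading_coeff_0_iff)
    ultimately show ?thesis by simp
  qed
  ultimately have "f = 0" by (meson not_le)
  thus ?thesis using coeff_f[of j] coeff_f[of 0] \<open>j < p\<close> by simp
qed

text \<open>
  The value at \<open>\<beta> = 0\<close> is lowered by \<open>\<gamma>\<close>, which turns the equation into a vanishing sum; then all
  \<open>p\<close> coefficients coincide and the total determines them. The condition is multiplied
  by \<open>p\<close> so that it speaks of integers although \<open>(M - \<gamma>) / p\<close> need not be one.
\<close>

lemma character_sum_eq_int_iff:
  fixes w :: "nat \<Rightarrow> nat" and \<zeta> :: complex and \<gamma> M :: int
  assumes p: "prime p" and \<zeta>: "\<zeta> ^ p = 1" "\<zeta> \<noteq> 1"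
    and total: "int (\<Sum>\<beta><p. w \<beta>) = M"
  shows "(\<Sum>\<beta><p. of_nat (w \<beta>) * \<zeta> ^ \<beta>) = of_int \<gamma> \<longleftrightarrow>
    (\<forall>\<beta><p. int p * int (w \<beta>) = M - \<gamma> + (if \<beta> = 0 then int p * \<gamma> else 0))"
    (is "?sum = _ \<longleftrightarrow> ?flat")
proof -
  have p_pos: "p > 0" using p by (rule prime_gt_0_nat)
  have geometric: "(\<Sum>j<p. \<zeta> ^ j) = 0"
    using \<zeta> by (simp add: geometric_sum)
  define c where "c \<beta> = int (w \<beta>) - (if \<beta> = 0 then \<gamma> else 0)" for \<beta>
  have "(\<Sum>\<beta><p. of_int (if \<beta> = 0 then \<gamma> else 0) * \<zeta> ^ \<beta>) = (\<Sum>\<beta><p. if \<beta> = 0 then of_int \<gamma> else 0)"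
    by (rule sum.cong) auto
  hence vanish_iff: "?sum = of_int \<gamma> \<longleftrightarrow> (\<Sum>\<beta><p. of_int (c \<beta>) * \<zeta> ^ \<beta>) = 0"
    using p_pos by (simp add: c_def left_diff_distrib sum_subtractf)
  have sum_c: "(\<Sum>\<beta><p. c \<beta>) = M - \<gamma>"
    using p_pos total by (simp add: c_def sum_subtractf)
  have flat_iff: "?flat \<longleftrightarrow> (\<forall>\<beta><p. int p * c \<beta> = M - \<gamma>)"
    by (auto simp: c_def algebra_simps)
  show ?thesis
  proof
    assume "?sum = of_int \<gamma>"
    hence const: "c \<beta> = c 0" if "\<beta> < p" for \<beta>
      using vanishing_int_combination_of_prime_roots[OF p \<zeta>] vanish_iff that by blast
    hence "(\<Sum>\<beta><p. c \<beta>) = (\<Sum>\<beta><p. c 0)" by (intro sum.cong refl) (metis lessThan_iff)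
    hence "int p * c 0 = M - \<gamma>" using sum_c by simp
    thus ?flat using const flat_iff by metis
  next
    assume ?flat
    hence "int p * c \<beta> = int p * c 0" if "\<beta> < p" for \<beta>
      using flat_iff that p_pos by metis
    hence "c \<beta> = c 0" if "\<beta> < p" for \<beta>
      using that p_pos by (metis mult_cancel_left of_nat_0_less_iff less_irrefl)
    hence "(\<Sum>\<beta><p. of_int (c \<beta>) * \<zeta> ^ \<beta>) = (\<Sum>\<beta><p. of_int (c 0) * \<zeta> ^ \<beta>)"
      by (intro sum.cong refl) (metis lessThan_iff)
    hence "(\<Sum>\<beta><p. of_int (c \<beta>) * \<zeta> ^ \<beta>) = of_int (c 0) * (\<Sum>\<beta><p. \<zeta> ^ \<beta>)"
      by (simp add: sum_distrib_left)
    thus "?sum = of_int \<gamma>" using geometric vanish_iff by simp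
  qed
qed

section \<open>The autocorrelation as a character sum\<close>

text \<open>
  The positions \<open>i\<close> for which neither \<open>a\<^sub>i\<close> nor \<open>a\<^sub>i\<^sub>+\<^sub>s\<close> is the zero entry of a period.
\<close>

definition lag_indices :: "nat \<Rightarrow> nat \<Rightarrow> nat set" where
  "lag_indices n s = {i \<in> {1..n}. (i + s) mod (n + 1) \<noteq> 0}"

text \<open>
  The residue of \<open>b\<^sub>i - b\<^sub>i\<^sub>+\<^sub>s\<close> modulo \<open>p\<close>; adding \<open>p\<close> first keeps the difference nonnegative.
\<close>

definition lag_exponent :: "nat \<Rightarrow> nat \<Rightarrow> (nat \<Rightarrow> nat) \<Rightarrow> nat \<Rightarrow> nat \<Rightarrow> nat" where
  "lag_exponent n p b s i = (b i + (p - b ((i + s) mod (n + 1)))) mod p"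

definition lag_count :: "nat \<Rightarrow> nat \<Rightarrow> (nat \<Rightarrow> nat) \<Rightarrow> nat \<Rightarrow> nat \<Rightarrow> nat" where
  "lag_count n p b s \<beta> = card {i \<in> lag_indices n s. lag_exponent n p b s i = \<beta>}"

lemma finite_lag_indices [simp]: "finite (lag_indices n s)"
  by (simp add: lag_indices_def)

lemma card_lag_indices:
  assumes "s \<in> {1..n}" shows "card (lag_indices n s) = n - 1"
proof -
  have "(i + s) mod (n + 1) = 0 \<longleftrightarrow> i = n + 1 - s" if "i \<in> {1..n}" for i
  proof
    assume "(i + s) mod (n + 1) = 0"
    then obtain k where k: "i + s = (n + 1) * k" by (auto elim: dvdE)
    have "0 < i + s" "i + s < (n + 1) * 2" using that assms by auto
    hence "0 < k" "k < 2" unfolding k by (simp_all only: nat_0_less_mult_iff mult_less_cancel1)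
    hence "k = 1" by simp
    thus "i = n + 1 - s" using k by simp
  qed (use assms in simp)
  hence "lag_indices n s = {i \<in> {1..n}. i \<noteq> n + 1 - s}"
    unfolding lag_indices_def by (intro Collect_cong conj_cong refl) simp
  also have "\<dots> = {1..n} - {n + 1 - s}" by auto
  finally have "lag_indices n s = {1..n} - {n + 1 - s}" .
  moreover have "n + 1 - s \<in> {1..n}" using assms by auto
  ultimately show ?thesis by (simp only: card_Diff_singleton card_atLeastAtMost diff_Suc_1)
qed

lemma sum_lag_count:
  assumes "p > 0" and "s \<in> {1..n}"
  shows "(\<Sum>\<beta><p. lag_count n p b s \<beta>) = n - 1"
proof -
  have "(\<Sum>\<beta><p. lag_count n p b s \<beta>) = (\<Sum>i\<in>lag_indices n s. 1)"
    unfolding lag_count_def card_eq_sum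
    by (rule sum.group) (use assms in \<open>auto simp: lag_exponent_def\<close>)
  thus ?thesis using card_lag_indices[OF assms(2)] by simp
qed

lemma periodic_mod:
  fixes a :: "nat \<Rightarrow> 'b"
  assumes "\<And>i. a (i + N) = a i"
  shows "a (i mod N) = a i"
proof -
  have "a (j + k * N) = a j" for j k
    by (induction k) (auto simp: assms add.assoc[symmetric] add.commute[of N])
  from this[of "i mod N" "i div N"] show ?thesis by simp
qed

lemma power_mult_cnj_power:
  fixes \<zeta> :: complex
  assumes "p > 0" and \<zeta>: "\<zeta> ^ p = 1" and "c < p"
  shows "\<zeta> ^ b * cnj (\<zeta> ^ c) = \<zeta> ^ ((b + (p - c)) mod p)"
proof -
  have "norm \<zeta> ^ p = 1" using \<zeta> by (metis norm_one norm_power)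
  hence "norm \<zeta> = 1" using assms(1) power_eq_imp_eq_base[of "norm \<zeta>" p 1] by simp
  hence unit: "\<zeta> ^ c * cnj (\<zeta> ^ c) = 1"
    using complex_norm_square[of "\<zeta> ^ c"] by (simp add: norm_power del: complex_cnj_power)
  have "\<zeta> ^ b * cnj (\<zeta> ^ c) = \<zeta> ^ b * (\<zeta> ^ (p - c) * \<zeta> ^ c) * cnj (\<zeta> ^ c)"
    using assms by (simp flip: power_add)
  also have "\<dots> = \<zeta> ^ (b + (p - c)) * (\<zeta> ^ c * cnj (\<zeta> ^ c))"
    by (simp add: power_add mult_ac)
  also have "\<dots> = \<zeta> ^ (b + (p - c))" by (simp only: unit mult_1_right)
  also have "\<dots> = \<zeta> ^ ((b + (p - c)) mod p)"
    by (rule periodic_mod[symmetric]) (simp add: power_add \<zeta>)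
  finally show ?thesis .
qed

lemma autocorrelation_eq_character_sum:
  fixes a :: "nat \<Rightarrow> complex"
  assumes "p > 0" and \<zeta>: "\<zeta> ^ p = 1"
    and periodic: "\<And>i. a (i + (n + 1)) = a i" and a0: "a 0 = 0"
    and exponents: "\<And>i. i \<in> {1..n} \<Longrightarrow> b i < p \<and> a i = \<zeta> ^ b i"
  shows "autocorrelation (n + 1) a s = (\<Sum>\<beta><p. of_nat (lag_count n p b s \<beta>) * \<zeta> ^ \<beta>)"
proof -
  have "autocorrelation (n + 1) a s = (\<Sum>i<n + 1. a i * cnj (a ((i + s) mod (n + 1))))"
    by (simp only: autocorrelation_def periodic_mod[of a "n + 1", OF periodic])
  \<comment> \<open>Only the terms in which both factors are roots of unity survive.\<close>
  also have "\<dots> = (\<Sum>i\<in>lag_indices n s. \<zeta> ^ lag_exponent n p b s i)"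
  proof (rule sum.mono_neutral_cong_right)
    show "\<forall>i\<in>{..<n + 1} - lag_indices n s. a i * cnj (a ((i + s) mod (n + 1))) = 0"
    proof
      fix i assume "i \<in> {..<n + 1} - lag_indices n s"
      hence "i = 0 \<or> (i + s) mod (n + 1) = 0" by (auto simp: lag_indices_def)
      thus "a i * cnj (a ((i + s) mod (n + 1))) = 0" by (auto simp: a0)
    qed
    show "a i * cnj (a ((i + s) mod (n + 1))) = \<zeta> ^ lag_exponent n p b s i"
      if "i \<in> lag_indices n s" for i
    proof -
      define j where "j = (i + s) mod (n + 1)"
      have "i \<in> {1..n}" "j \<noteq> 0" using that by (auto simp: lag_indices_def j_def)
      moreover have "j < n + 1" unfolding j_def by simp
      ultimately have "i \<in> {1..n}" "j \<in> {1..n}" by auto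
      thus ?thesis
        using exponents power_mult_cnj_power[OF assms(1) \<zeta>, of "b j" "b i"]
        unfolding lag_exponent_def j_def[symmetric] by metis
    qed
  qed (auto simp: lag_indices_def)
  also have "\<dots> = (\<Sum>\<beta><p. \<Sum>i\<in>{i \<in> lag_indices n s. lag_exponent n p b s i = \<beta>}. \<zeta> ^ lag_exponent n p b s i)"
    by (rule sum.group[symmetric]) (use assms(1) in \<open>auto simp: lag_exponent_def\<close>)
  also have "\<dots> = (\<Sum>\<beta><p. of_nat (lag_count n p b s \<beta>) * \<zeta> ^ \<beta>)"
    by (simp add: lag_count_def)
  finally show ?thesis .
qed

section \<open>Coordinates on a product of two cyclic groups\<close>

locale cyclic_coordinates = group G for G (structure) +
  fixes g h :: 'a and p N :: nat
  assumes g_carrier [simp]: "g \<in> carrier G" and h_carrier [simp]: "h \<in> carrier G"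
    and ord_g: "ord g = p" and ord_h: "ord h = N" and p_pos: "p > 0" and N_pos: "N > 0"
    and direct: "internal_direct_product G (generate G {h}) (generate G {g})"
begin

text \<open>
  The isomorphism \<open>H \<times> P \<cong> G\<close> has \<open>H\<close> as its first factor, whereas points are written \<open>g\<^sup>k h\<^sup>l\<close>; the
  commutation rule mediates between the two orders and lets exponents be subtracted separately.
\<close>

lemma
  shows meet: "generate G {h} \<inter> generate G {g} = {\<one>}"
    and product: "generate G {h} <#> generate G {g} = carrier G"
    and commute: "g [^] (k :: int) \<otimes> h [^] (l :: int) = h [^] l \<otimes> g [^] k"
proof -
  have "subgroup (generate G {h}) G" "subgroup (generate G {g}) G"
    using direct by (auto simp: internal_direct_product_def)
  then interpret group_disjoint_sum G "generate G {h}" "generate G {g}"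
    by (simp add: group_disjoint_sum_def is_group)
  have facts: "generate G {h} \<inter> generate G {g} = {\<one>}"
    "generate G {h} <#> generate G {g} = carrier G"
    "\<forall>x\<in>generate G {h}. \<forall>y\<in>generate G {g}. x \<otimes> y = y \<otimes> x"
    using direct iso_group_mul_alt by (auto simp: internal_direct_product_def)
  show "generate G {h} \<inter> generate G {g} = {\<one>}" "generate G {h} <#> generate G {g} = carrier G"
    by (fact facts)+
  show "g [^] k \<otimes> h [^] l = h [^] l \<otimes> g [^] k"
    by (rule facts(3)[rule_format, symmetric]) (auto simp: generate_pow)
qed

definition elt :: "int \<Rightarrow> int \<Rightarrow> 'a" where
  "elt k l = g [^] k \<otimes> h [^] l"

lemma elt_closed [simp]: "elt k l \<in> carrier G"
  by (simp add: elt_def)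

lemma elt_quotient: "elt k l \<otimes> inv (elt k' l') = elt (k - k') (l - l')"
proof -
  have "elt k l \<otimes> inv (elt k' l') = g [^] k \<otimes> h [^] l \<otimes> (h [^] (- l') \<otimes> g [^] (- k'))"
    by (simp add: elt_def inv_mult_group int_pow_neg)
  also have "\<dots> = g [^] k \<otimes> (h [^] l \<otimes> h [^] (- l')) \<otimes> g [^] (- k')"
    by (simp add: m_assoc)
  also have "\<dots> = g [^] k \<otimes> (h [^] (l - l') \<otimes> g [^] (- k'))"
    by (simp add: m_assoc flip: int_pow_mult)
  also have "\<dots> = g [^] k \<otimes> g [^] (- k') \<otimes> h [^] (l - l')"
    by (simp add: m_assoc commute)
  finally show ?thesis by (simp add: elt_def flip: int_pow_mult)
qed

lemma elt_eq_one_iff: "elt k l = \<one> \<longleftrightarrow> int p dvd k \<and> int N dvd l"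
proof
  assume "elt k l = \<one>"
  hence "g [^] k = h [^] (- l)"
    by (simp add: elt_def int_pow_neg inv_equality[symmetric])
  moreover have "g [^] k \<in> generate G {g}" "h [^] (- l) \<in> generate G {h}"
    by (auto simp: generate_pow)
  ultimately have "g [^] k = \<one>" "h [^] (- l) = \<one>"
    using meet by auto
  thus "int p dvd k \<and> int N dvd l" by (simp add: int_pow_eq_id ord_g ord_h)
next
  assume "int p dvd k \<and> int N dvd l"
  hence "g [^] k = \<one>" "h [^] l = \<one>" by (simp_all add: int_pow_eq_id ord_g ord_h)
  thus "elt k l = \<one>" by (simp add: elt_def)
qed

lemma elt_eq_iff: "elt k l = elt k' l' \<longleftrightarrow> int p dvd k - k' \<and> int N dvd l - l'"
proof -
  have "elt k l = elt k' l' \<longleftrightarrow> elt k l \<otimes> inv (elt k' l') = \<one>"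
    by (metis elt_closed inv_closed inv_equality inv_inv r_inv)
  thus ?thesis by (simp add: elt_quotient elt_eq_one_iff)
qed

lemma elt_in_h_iff: "elt k l \<in> generate G {h} \<longleftrightarrow> int p dvd k"
proof -
  have "elt k l \<in> generate G {h} \<longleftrightarrow> (\<exists>l'. elt k l = elt 0 l')"
    by (auto simp: generate_pow elt_def)
  also have "\<dots> \<longleftrightarrow> int p dvd k"
    unfolding elt_eq_iff by (auto intro: exI[of _ l])
  finally show ?thesis .
qed

lemma elt_in_g_iff: "elt k l \<in> generate G {g} \<longleftrightarrow> int N dvd l"
proof -
  have "elt k l \<in> generate G {g} \<longleftrightarrow> (\<exists>k'. elt k l = elt k' 0)"
    by (auto simp: generate_pow elt_def)
  also have "\<dots> \<longleftrightarrow> int N dvd l"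
    unfolding elt_eq_iff by (auto intro: exI[of _ k])
  finally show ?thesis .
qed

text \<open>
  The exponent of \<open>h\<close> is normalised to \<open>- s\<close>, because a quotient \<open>r\<^sub>i r\<^sub>j\<^sup>-\<^sup>1\<close> with \<open>j \<equiv> i + s\<close> lies over
  \<open>h\<^sup>-\<^sup>s\<close>.
\<close>

lemma elt_residues:
  assumes "x \<in> carrier G"
  obtains \<beta> s where "\<beta> < p" "s < N" "x = elt (int \<beta>) (- int s)"
proof -
  obtain y z where "y \<in> generate G {h}" "z \<in> generate G {g}" "x = y \<otimes> z"
    using assms unfolding product[symmetric] set_mult_def by blast
  then obtain k l where x: "x = elt k l"
    by (auto simp: generate_pow elt_def commute)
  define \<beta> s where "\<beta> = nat (k mod int p)" and "s = nat ((- l) mod int N)"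
  have eqs: "int \<beta> = k mod int p" "int s = (- l) mod int N"
    using p_pos N_pos by (auto simp: \<beta>_def s_def)
  have "int p dvd k - k mod int p" by (simp add: minus_mod_eq_mult_div)
  moreover have "int N dvd (- l) - (- l) mod int N"
    by (simp only: minus_mod_eq_mult_div dvd_triv_left)
  hence "int N dvd l - (- ((- l) mod int N))"
    by (metis dvd_minus_iff minus_diff_eq diff_minus_eq_add add.commute)
  ultimately have "x = elt (int \<beta>) (- int s)"
    by (simp only: x elt_eq_iff eqs)
  moreover have "\<beta> < p" "s < N"
    using eqs p_pos N_pos by (metis of_nat_0_less_iff of_nat_less_iff pos_mod_bound)+
  ultimately show ?thesis using that by blast
qed

lemma finite_carrier: "finite (carrier G)"
proof -
  have "carrier G = (\<lambda>(\<beta>, s). elt (int \<beta>) (- int s)) ` ({..<p} \<times> {..<N})"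
    by (force elim: elt_residues)
  thus ?thesis by simp
qed

end

section \<open>Differences in the graph of the exponent sequence\<close>

locale graph_set = cyclic_coordinates G g h p "n + 1" for G (structure) and g h :: 'a and p n :: nat +
  fixes b :: "nat \<Rightarrow> nat"
  assumes b_less: "i \<in> {1..n} \<Longrightarrow> b i < p"
begin

definition point :: "nat \<Rightarrow> 'a" where
  "point i = elt (int (b i)) (int i)"

lemma dvd_index_diff_iff:
  assumes "i \<in> {1..n}" "j \<in> {1..n}"
  shows "int (n + 1) dvd int i - int j \<longleftrightarrow> i = j"
proof
  assume "int (n + 1) dvd int i - int j"
  hence "int i mod int (n + 1) = int j mod int (n + 1)" by (simp add: mod_eq_dvd_iff)
  hence "i mod (n + 1) = j mod (n + 1)" by (metis of_nat_eq_iff of_nat_mod)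
  thus "i = j" using assms by simp
qed simp

lemma inj_on_point: "inj_on point {1..n}"
  using dvd_index_diff_iff by (simp add: inj_on_def point_def elt_eq_iff)

lemma card_points: "card (point ` {1..n}) = n"
  using card_image[OF inj_on_point] by simp

lemma point_quotient_eq_iff:
  assumes "i \<in> {1..n}" "j \<in> {1..n}" "\<beta> < p"
  shows "point i \<otimes> inv (point j) = elt (int \<beta>) (- int s) \<longleftrightarrow>
    j = (i + s) mod (n + 1) \<and> (b i + (p - b j)) mod p = \<beta>"
proof -
  have "int (n + 1) dvd int i - int j - (- int s) \<longleftrightarrow> (int (i + s)) mod int (n + 1) = int j mod int (n + 1)"
    by (simp add: mod_eq_dvd_iff algebra_simps)
  also have "\<dots> \<longleftrightarrow> (i + s) mod (n + 1) = j mod (n + 1)"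
    by (metis of_nat_eq_iff of_nat_mod)
  finally have h_part: "int (n + 1) dvd int i - int j - (- int s) \<longleftrightarrow> j = (i + s) mod (n + 1)"
    using assms(2) by auto
  have "int p dvd int (b i) - int (b j) - int \<beta> \<longleftrightarrow> int p dvd int (b i + (p - b j)) - int \<beta>"
    using b_less[OF assms(2)] dvd_add_right_iff[of "int p" "int p" "int (b i) - int (b j) - int \<beta>"]
    by (simp add: algebra_simps)
  also have "\<dots> \<longleftrightarrow> int (b i + (p - b j)) mod int p = int \<beta> mod int p"
    by (simp add: mod_eq_dvd_iff)
  also have "\<dots> \<longleftrightarrow> (b i + (p - b j)) mod p = \<beta> mod p"
    by (metis of_nat_eq_iff of_nat_mod)
  finally have "int p dvd int (b i) - int (b j) - int \<beta> \<longleftrightarrow> (b i + (p - b j)) mod p = \<beta>"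
    using assms(3) by simp
  with h_part show ?thesis by (auto simp: point_def elt_quotient elt_eq_iff)
qed

text \<open>
  The representations are indexed by \<open>i\<close>: given the position \<open>i\<close> of the numerator, comparing the
  exponents of \<open>h\<close> forces the denominator to be the point over \<open>i + s\<close> (reduced modulo \<open>n + 1\<close>).
  The shift is nonzero, so the two points are automatically different.
\<close>

lemma difference_count_eq_lag_count:
  assumes "\<beta> < p" "s \<in> {1..n}"
  shows "difference_count G (point ` {1..n}) (elt (int \<beta>) (- int s)) = lag_count n p b s \<beta>"
proof -
  define L where "L = {i \<in> lag_indices n s. lag_exponent n p b s i = \<beta>}"
  define succ where "succ i = (i + s) mod (n + 1)" for i
  have L_iff: "i \<in> L \<longleftrightarrow> i \<in> {1..n} \<and> succ i \<in> {1..n} \<and>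
      point i \<otimes> inv (point (succ i)) = elt (int \<beta>) (- int s)" for i
  proof -
    have "succ i < n + 1" unfolding succ_def by simp
    hence "succ i \<noteq> 0 \<longleftrightarrow> succ i \<in> {1..n}" by auto
    thus ?thesis
      using point_quotient_eq_iff[of i "succ i" \<beta> s] assms
      by (auto simp: L_def lag_indices_def lag_exponent_def succ_def simp del: add_Suc_right)
  qed
  have "{(r, r'). r \<in> point ` {1..n} \<and> r' \<in> point ` {1..n} \<and> r \<noteq> r' \<and>
      r \<otimes> inv r' = elt (int \<beta>) (- int s)} = (\<lambda>i. (point i, point (succ i))) ` L"
    (is "?D = _")
  proof (intro equalityI subsetI)
    fix z assume "z \<in> ?D"
    then obtain i j where ij: "i \<in> {1..n}" "j \<in> {1..n}" "z = (point i, point j)"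
      "point i \<otimes> inv (point j) = elt (int \<beta>) (- int s)" by auto
    hence "j = succ i" using point_quotient_eq_iff assms by (auto simp: succ_def)
    thus "z \<in> (\<lambda>i. (point i, point (succ i))) ` L" using ij L_iff by auto
  next
    fix z assume "z \<in> (\<lambda>i. (point i, point (succ i))) ` L"
    then obtain i where i: "i \<in> L" "z = (point i, point (succ i))" by auto
    have "elt (int \<beta>) (- int s) \<noteq> \<one>"
      using assms(2) by (auto simp: elt_eq_one_iff dest: zdvd_imp_le)
    hence "point i \<noteq> point (succ i)"
      using i L_iff by (auto simp: point_def)
    thus "z \<in> ?D" using i L_iff by auto
  qed
  moreover have "inj_on (\<lambda>i. (point i, point (succ i))) L"
    by (rule inj_onI) (use L_iff inj_onD[OF inj_on_point] in blast)
  ultimately show ?thesis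
    by (simp add: difference_count_def card_image lag_count_def L_def)
qed

text \<open>
  There is at most one point over each power of \<open>h\<close>, so a quotient lying over \<open>h\<^sup>0\<close> comes from \<open>i = j\<close>.
\<close>

lemma difference_count_g_eq_0:
  assumes "x \<in> generate G {g}"
  shows "difference_count G (point ` {1..n}) x = 0"
proof -
  have "i = j" if "i \<in> {1..n}" "j \<in> {1..n}" "point i \<otimes> inv (point j) = x" for i j
    using that assms dvd_index_diff_iff[OF that(1,2)]
    by (auto simp only: point_def elt_quotient elt_in_g_iff)
  hence "{(r, r'). r \<in> point ` {1..n} \<and> r' \<in> point ` {1..n} \<and> r \<noteq> r' \<and> r \<otimes> inv r' = x} = {}"
    by blast
  thus ?thesis by (simp only: difference_count_def card.empty)
qed

text \<open>
  The elements \<open>g\<^sup>\<beta> h\<^sup>-\<^sup>s\<close> with \<open>s \<noteq> 0\<close> exhaust the complement of \<open>P\<close>, and those with \<open>\<beta> = 0\<close> are the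
  ones in \<open>H\<close>; so the conditions on \<open>H\<close> and on \<open>G - (H \<union> P)\<close> become conditions on the lag counts.
\<close>

lemma direct_product_difference_set_iff:
  "direct_product_difference_set G (generate G {h}) (generate G {g}) (point ` {1..n})
     (n + 1) p n l1 0 \<mu> \<longleftrightarrow>
   (\<forall>s\<in>{1..n}. \<forall>\<beta><p. of_nat (lag_count n p b s \<beta>) = (if \<beta> = 0 then l1 else \<mu>))"
  (is "_ \<longleftrightarrow> ?counts")
proof -
  let ?R = "point ` {1..n}" and ?H = "generate G {h}" and ?P = "generate G {g}"
  have h_dvd: "int (n + 1) dvd - int s \<longleftrightarrow> s = 0" if "s < n + 1" for s
    using that by (auto dest: dvd_imp_le simp only: dvd_minus_iff int_dvd_int_iff)
  have g_dvd: "int p dvd int \<beta> \<longleftrightarrow> \<beta> = 0" if "\<beta> < p" for \<beta>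
    using that by (auto dest: dvd_imp_le)
  have "(\<forall>x\<in>?H - {\<one>}. of_nat (difference_count G ?R x) = l1) \<and>
      (\<forall>x\<in>carrier G - (?H \<union> ?P). of_nat (difference_count G ?R x) = \<mu>) \<longleftrightarrow> ?counts"
    (is "?H_counts \<and> ?G_counts \<longleftrightarrow> _")
  proof (intro iffI conjI ballI allI impI)
    fix s \<beta> assume *: "?H_counts \<and> ?G_counts" "s \<in> {1..n}" "\<beta> < p"
    let ?x = "elt (int \<beta>) (- int s)"
    have "?x \<notin> ?P" "?x \<in> ?H \<longleftrightarrow> \<beta> = 0" "?x \<noteq> \<one>"
      using *(2,3) h_dvd[of s] by (auto simp: elt_in_g_iff elt_in_h_iff g_dvd elt_eq_one_iff)
    thus "of_nat (lag_count n p b s \<beta>) = (if \<beta> = 0 then l1 else \<mu>)"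
      using * difference_count_eq_lag_count[OF *(3,2)] by (auto simp flip: difference_count_eq_lag_count)
  next
    fix x assume *: ?counts "x \<in> ?H - {\<one>}"
    hence "x \<in> carrier G" by (auto simp: generate_pow)
    then obtain \<beta> s where x: "\<beta> < p" "s < n + 1" "x = elt (int \<beta>) (- int s)"
      by (rule elt_residues)
    hence "\<beta> = 0" "s \<in> {1..n}"
      using *(2) h_dvd[of s] by (auto simp: elt_in_h_iff g_dvd elt_eq_one_iff)
    thus "of_nat (difference_count G ?R x) = l1"
      using * x difference_count_eq_lag_count[of \<beta> s] by simp
  next
    fix x assume *: ?counts "x \<in> carrier G - (?H \<union> ?P)"
    then obtain \<beta> s where x: "\<beta> < p" "s < n + 1" "x = elt (int \<beta>) (- int s)"
      by (blast elim: elt_residues)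
    hence "\<not> int p dvd int \<beta>" "\<not> int (n + 1) dvd - int s"
      using *(2) by (simp_all only: elt_in_h_iff elt_in_g_iff Un_iff Diff_iff de_Morgan_disj
          not_False_eq_True)
    hence "\<beta> \<noteq> 0" "s \<in> {1..n}"
      using x by (auto simp: Suc_le_eq intro: Nat.gr0I)
    thus "of_nat (difference_count G ?R x) = \<mu>"
      using * x difference_count_eq_lag_count[of \<beta> s] by simp
  qed
  moreover have "?R \<subseteq> carrier G" by (auto simp: point_def)
  moreover have "card ?H = n + 1" "card ?P = p"
    by (simp_all add: ord_g ord_h flip: generate_pow_card)
  ultimately show ?thesis
    using direct finite_carrier card_points difference_count_g_eq_0
    by (auto simp: direct_product_difference_set_def)
qed

end

section \<open>Nearly perfect sequences and direct product difference sets\<close>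

theorem theorem3:
  fixes G (structure) and h g :: 'a and H P R :: "'a set"
    and p n :: nat and \<gamma> :: int and \<zeta> :: complex
    and a :: "nat \<Rightarrow> complex" and b :: "nat \<Rightarrow> nat"
  assumes "Factorial_Ring.prime p" and "n \<ge> 2"
    and "almost_p_ary_sequence p (n + 1) a"
    and "h \<in> carrier G" and "H = generate G {h}" and "card H = n + 1"
    and "g \<in> carrier G" and "P = generate G {g}" and "card P = p"
    and "internal_direct_product G H P"
    and "primitive_root_of_unity p \<zeta>"
    and "\<forall>i\<in>{1..n}. b i \<in> {0..p - 1} \<and> a i = \<zeta> ^ b i"
    and "R = {g [^] b i \<otimes> h [^] i | i. i \<in> {1..n}}"
  shows "(almost_p_ary_nearly_perfect p (n + 1) (of_int \<gamma>) a \<longleftrightarrow>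
           direct_product_difference_set G H P R (n + 1) p n
             ((of_nat n - of_int \<gamma> - 1) / of_nat p + of_int \<gamma>)
             0
             ((of_nat n - of_int \<gamma> - 1) / of_nat p))
       \<and> (almost_p_ary_nearly_perfect p (n + 1) (of_int \<gamma>) a \<longrightarrow> int p dvd int n - \<gamma> - 1)"
proof -
  have p1: "p > 1" using assms(1) by (rule prime_gt_1_nat)
  interpret group G using assms(10) by (simp add: internal_direct_product_def)
  interpret graph_set G g h p n b
  proof unfold_locales
    show "ord g = p" "ord h = n + 1"
      using assms by (simp_all add: generate_pow_card)
    show "b i < p" if "i \<in> {1..n}" for i
      using assms(12) that p1 by fastforce
  qed (use assms p1 in auto)
  have R: "R = point ` {1..n}"
    by (auto simp: assms(13) point_def elt_def int_pow_int image_def)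
  have \<zeta>: "\<zeta> ^ p = 1" "\<zeta> \<noteq> 1"
    using assms(11) p1 unfolding primitive_root_of_unity_def
    by (blast, metis atLeastLessThan_iff order_refl power_one)
  define \<mu> :: rat where "\<mu> = (of_nat n - of_int \<gamma> - 1) / of_nat p"
  \<comment> \<open>Clearing the denominator \<open>p\<close> puts the parameters in the form in which the character sum gives them.\<close>
  have rat_iff: "of_nat w = (if \<beta> = 0 then \<mu> + of_int \<gamma> else \<mu>) \<longleftrightarrow>
      int p * int w = int (n - 1) - \<gamma> + (if \<beta> = 0 then int p * \<gamma> else 0)" for w and \<beta> :: nat
  proof -
    have "of_nat w = (if \<beta> = 0 then \<mu> + of_int \<gamma> else \<mu>) \<longleftrightarrow>
      rat_of_int (int p * int w) = of_int (int n - 1 - \<gamma> + (if \<beta> = 0 then int p * \<gamma> else 0))"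
      using p1 by (auto simp: \<mu>_def field_simps)
    also have "\<dots> \<longleftrightarrow> int p * int w = int (n - 1) - \<gamma> + (if \<beta> = 0 then int p * \<gamma> else 0)"
      unfolding of_int_eq_iff using assms(2) by simp
    finally show ?thesis .
  qed
  have a: "\<And>i. a (i + (n + 1)) = a i" "a 0 = 0"
    using assms(3) by (auto simp: almost_p_ary_sequence_def)
  have auto_iff: "autocorrelation (n + 1) a s = of_int \<gamma> \<longleftrightarrow>
      (\<forall>\<beta><p. int p * int (lag_count n p b s \<beta>) = int (n - 1) - \<gamma> + (if \<beta> = 0 then int p * \<gamma> else 0))"
    if "s \<in> {1..n}" for s
  proof -
    have "autocorrelation (n + 1) a s = (\<Sum>\<beta><p. of_nat (lag_count n p b s \<beta>) * \<zeta> ^ \<beta>)"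
      using a \<zeta>(1) assms(12) b_less p_pos by (intro autocorrelation_eq_character_sum) auto
    thus ?thesis
      using character_sum_eq_int_iff[OF assms(1) \<zeta>, of "lag_count n p b s" "int (n - 1)" \<gamma>]
        sum_lag_count[OF p_pos that, of b] by simp
  qed
  have nps_iff: "almost_p_ary_nearly_perfect p (n + 1) (of_int \<gamma>) a \<longleftrightarrow>
      (\<forall>s\<in>{1..n}. \<forall>\<beta><p. int p * int (lag_count n p b s \<beta>)
         = int (n - 1) - \<gamma> + (if \<beta> = 0 then int p * \<gamma> else 0))"
    using assms(3) auto_iff by (simp add: almost_p_ary_nearly_perfect_def atLeastLessThanSuc_atLeastAtMost)
  have "almost_p_ary_nearly_perfect p (n + 1) (of_int \<gamma>) a \<longleftrightarrow>
      direct_product_difference_set G H P R (n + 1) p n (\<mu> + of_int \<gamma>) 0 \<mu>"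
    unfolding nps_iff R assms(5,8) direct_product_difference_set_iff rat_iff ..
  moreover have "int p dvd int n - \<gamma> - 1" if "almost_p_ary_nearly_perfect p (n + 1) (of_int \<gamma>) a"
  proof -
    \<comment> \<open>Any \<open>\<beta> \<noteq> 0\<close> shows that \<open>\<mu>\<close> is an integer, and \<open>\<beta> = 1\<close> is available because \<open>p \<ge> 2\<close>.\<close>
    have "int p * int (lag_count n p b 1 1) = int (n - 1) - \<gamma>"
      using that[unfolded nps_iff] p1 assms(2) by simp
    hence "int n - \<gamma> - 1 = int p * int (lag_count n p b 1 1)"
      using assms(2) by simp
    thus ?thesis by simp
  qed
  ultimately show ?thesis unfolding \<mu>_def by blast
qed

end
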